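(* Let $n \ge 1$ be an integer, let $\mu$ be an arbitrary continuous probability distribution on the real line $\mathbb{R}$, and let $X_1,\dots,X_n,Y_1,\dots,Y_n$ be independent random variables each with distribution $\mu$. Then the probability that $$\sum_{i=1}^k X_i > \sum_{i=1}^k Y_i \quad \text{for all } k \text{ with } 1 \le k \le n$$ is $\binom{2n}{n}/4^n$.
   Context: A probability distribution $\mu$ on $\mathbb{R}$ is continuous if it has no atoms, i.e. $\mu(\{x\}) = 0$ for every $x \in \mathbb{R}$. *)

theory Defs
  imports "HOL-Probability.Probability"
begin

end

theory Submission
  imports Defs "HOL-Computational_Algebra.Formal_Power_Series"
begin

text \<open>
  Let \<open>S\<^sub>k\<close> be the \<open>k\<close>-th partial sum of the differences of the two sequences and
  \<open>p n\<close> the probability that \<open>S\<^sub>1, \<dots>, S\<^sub>n\<close> are all positive. The sequence \<open>p\<close> is pinned down by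
  looking at where the path \<open>S\<^sub>0, \<dots>, S\<^sub>n\<close> attains its minimum.

  Because the step law has no atoms, almost surely no two of the values \<open>S\<^sub>0, \<dots>, S\<^sub>n\<close> agree, so
  the minimum is attained at exactly one time \<open>k\<close>. That this time is a given \<open>k\<close> means that the
  path, seen from time \<open>k\<close>, is positive both at all later and at all earlier times. The later part
  uses the steps from \<open>k\<close> to \<open>n\<close> and has probability \<open>p (n - k)\<close>. The earlier part uses the other
  steps, run backwards and with opposite sign; since a step is the difference of two independent
  variables with the same law, reversing the time and exchanging the two sequences preserves the
  joint law, and this part has probability \<open>p k\<close>. The two parts are independent, so the
  minimum is at \<open>k\<close> with probability \<open>p k * p (n - k)\<close> (lemma \<open>prob_minimum_at\<close>), and summing
  over \<open>k\<close> gives \<open>(\<Sum>k\<le>n. p k * p (n - k)) = 1\<close> for every \<open>n\<close>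
  (lemma \<open>prob_stays_positive_convolution\<close>).

  Hence the generating function of \<open>p\<close> is a square root of \<open>1 / (1 - x)\<close>. As \<open>p 0 = 1\<close>, it is
  \<open>(1 - x)\<close> to the power \<open>- 1 / 2\<close>, whose coefficients are \<open>((2 * n) choose n) / 4 ^ n\<close>
  (lemma \<open>unique_convolution_square_root\<close>).

  The computation takes place on the product space \<open>W\<close> of infinitely many copies of the given law,
  indexed by \<open>nat + nat\<close> with one summand for each of the two sequences. There, all symmetries in
  use are injective renamings of the coordinates, and one lemma (\<open>prob_reindex\<close>) covers them.
\<close>

section \<open>The convolution square root of the constant sequence 1\<close>

lemma gbinomial_minus_half:
  "(- (1 / 2) :: real) gchoose k = (- 1) ^ k * (real ((2 * k) choose k) / 4 ^ k)"
proof (induction k)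
  case 0
  show ?case by simp
next
  case (Suc k)
  have factorials: "real ((2 * m) choose m) = fact (2 * m) / (fact m * fact m)" for m
    by (simp add: binomial_fact)
  have central: "real ((2 * Suc k) choose Suc k) = 2 * (2 * real k + 1) * real ((2 * k) choose k) / (real k + 1)"
    unfolding factorials by (simp add: divide_simps) (simp add: algebra_simps)
  have "(- (1 / 2) :: real) gchoose Suc k = (- (1 / 2) gchoose k) * (- (1 / 2) - real k) / (real k + 1)"
    using gbinomial_mult_1[of "- (1/2) :: real" k] by (simp add: field_simps)
  also have "\<dots> = (- 1) ^ Suc k * (real ((2 * Suc k) choose Suc k) / 4 ^ Suc k)"
    unfolding Suc.IH central by (simp add: divide_simps) (simp add: algebra_simps)
  finally show ?case .
qed

text \<open>
  This is Vandermonde's identity with both upper arguments equal to \<open>- 1 / 2\<close>, that is, the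
  square of the series of \<open>(1 - x)\<close> to the power \<open>- 1 / 2\<close> is the geometric series.
\<close>
lemma central_binomial_convolution:
  "(\<Sum>k\<le>n. (real ((2 * k) choose k) / 4 ^ k) * (real ((2 * (n - k)) choose (n - k)) / 4 ^ (n - k))) = 1"
  (is "(\<Sum>k\<le>n. ?c k * ?c (n - k)) = 1")
proof -
  have "(- 1) ^ n * (\<Sum>k\<le>n. ?c k * ?c (n - k))
      = (\<Sum>k\<le>n. ((- (1 / 2)) gchoose k) * ((- (1 / 2)) gchoose (n - k)))"
    unfolding gbinomial_minus_half sum_distrib_left
    by (rule sum.cong) (auto simp: algebra_simps simp flip: power_add)
  also have "\<dots> = (- 1) gchoose n"
    using gbinomial_Vandermonde[of "- (1 / 2) :: real" "- (1 / 2)" n] by (simp add: atMost_atLeast0)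
  also have "\<dots> = (- 1) ^ n"
    using gbinomial_minus[of "1 :: real" n] by (simp add: binomial_gbinomial[symmetric])
  finally show ?thesis by simp
qed

text \<open>
  In the \<open>n\<close>-th coefficient of the square the value \<open>p n\<close> occurs only in the two outer summands
  \<open>p 0 * p n\<close>, and the others involve earlier values. So the square, together with the sign of
  \<open>p 0\<close>, determines \<open>p\<close> recursively.
\<close>
lemma convolution_square_unique:
  fixes p q :: "nat \<Rightarrow> real"
  assumes "p 0 > 0" "q 0 > 0"
    and same_square: "\<And>n. (\<Sum>k\<le>n. p k * p (n - k)) = (\<Sum>k\<le>n. q k * q (n - k))"
  shows "p n = q n"
proof (induction n rule: less_induct)
  case (less n)
  have p0: "p 0 = q 0"
    using same_square[of 0] assms(1,2) by (simp add: power2_eq_iff flip: power2_eq_square)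
  show ?case
  proof (cases n)
    case 0
    then show ?thesis using p0 by simp
  next
    case (Suc m)
    have split: "(\<Sum>k\<le>n. r k * r (n - k)) = 2 * r 0 * r n + (\<Sum>k<m. r (Suc k) * r (m - k))"
      for r :: "nat \<Rightarrow> real"
    proof -
      have "(\<Sum>k\<le>n. r k * r (n - k)) = r 0 * r n + (\<Sum>k\<le>m. r (Suc k) * r (m - k))"
        by (simp add: Suc sum.atMost_Suc_shift del: sum.atMost_Suc)
      also have "(\<Sum>k\<le>m. r (Suc k) * r (m - k)) = (\<Sum>k<m. r (Suc k) * r (m - k)) + r n * r 0"
        by (simp add: Suc flip: lessThan_Suc_atMost)
      finally show ?thesis by simp
    qed
    have "(\<Sum>k<m. p (Suc k) * p (m - k)) = (\<Sum>k<m. q (Suc k) * q (m - k))"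
      by (intro sum.cong refl arg_cong2[of _ _ _ _ "(*)"] less) (auto simp: Suc)
    then have "2 * q 0 * p n = 2 * q 0 * q n"
      using same_square[of n] unfolding split p0 by simp
    then show ?thesis using assms(2) by simp
  qed
qed

lemma unique_convolution_square_root:
  fixes p :: "nat \<Rightarrow> real"
  assumes "p 0 = 1" and "\<And>n. (\<Sum>k\<le>n. p k * p (n - k)) = 1"
  shows "p n = real ((2 * n) choose n) / 4 ^ n"
  by (rule convolution_square_unique)
     (simp_all add: assms central_binomial_convolution[simplified])

section \<open>Increments of the walk and renamings of its steps\<close>

text \<open>
  A point \<open>w\<close> records both sequences: \<open>w (Inl i)\<close> and \<open>w (Inr i)\<close> are the \<open>i\<close>-th entries, counted
  from 0, of the first and of the second one. The walk \<open>S\<close> of their differences enters through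
  \<open>increment w j l\<close>, which is \<open>S\<^sub>l - S\<^sub>j\<close> for \<open>j \<le> l\<close>. Taking the increments
  as the basic notion makes visible which coordinates an event depends on.
\<close>
definition increment :: "(nat + nat \<Rightarrow> real) \<Rightarrow> nat \<Rightarrow> nat \<Rightarrow> real" where
  "increment w j l = (\<Sum>i\<in>{j..<l}. w (Inl i) - w (Inr i))"

abbreviation window :: "nat \<Rightarrow> nat \<Rightarrow> (nat + nat) set" where
  "window j l \<equiv> {j..<l} <+> {j..<l}"

lemma increment_diff:
  "j \<le> l \<Longrightarrow> increment w j l = increment w 0 l - increment w 0 j"
  using sum.atLeastLessThan_concat[of 0 j l "\<lambda>i. w (Inl i) - w (Inr i)"]
  by (simp add: increment_def)

lemma increment_restrict:
  "window j l \<subseteq> J \<Longrightarrow> increment (restrict w J) j l = increment w j l"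
  unfolding increment_def by (intro sum.cong) (auto dest: subsetD[of _ _ "Inl _"] subsetD[of _ _ "Inr _"])

lemma measurable_increment:
  assumes "window j l \<subseteq> J"
  shows "(\<lambda>w. increment w j l) \<in> borel_measurable (PiM J (\<lambda>_. borel))"
  unfolding increment_def using assms
  by (intro borel_measurable_sum borel_measurable_diff measurable_component_singleton) auto

definition shift :: "nat \<Rightarrow> nat + nat \<Rightarrow> nat + nat" where
  "shift k = map_sum ((+) k) ((+) k)"

text \<open>
  Exchanging \<open>Inl\<close> and \<open>Inr\<close> changes the sign of every step. Indices from \<open>k\<close> on keep their
  place so that the renaming is injective on the whole index type.
\<close>
definition reversal :: "nat \<Rightarrow> nat + nat \<Rightarrow> nat + nat" where
  "reversal k = (\<lambda>x. let r = (\<lambda>i. if i < k then k - 1 - i else i)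
     in case x of Inl i \<Rightarrow> Inr (r i) | Inr i \<Rightarrow> Inl (r i))"

lemma inj_shift: "inj (shift k)"
  unfolding shift_def by (intro sum.inj_map) auto

lemma inj_reversal: "inj (reversal k)"
  by (rule injI) (auto simp: reversal_def split: sum.splits if_splits)

lemma increment_shift: "increment (w \<circ> shift k) j l = increment w (k + j) (k + l)"
  unfolding increment_def shift_def
  using sum.shift_bounds_nat_ivl[of "\<lambda>i. w (Inl i) - w (Inr i)" j k l]
  by (simp add: add.commute)

lemma increment_reversal:
  assumes "l \<le> k"
  shows "increment (w \<circ> reversal k) 0 l = - increment w (k - l) k"
proof -
  have "(\<Sum>i\<in>{k - l..<k}. w (Inr i) - w (Inl i)) = (\<Sum>i<l. w (Inr (k - 1 - i)) - w (Inl (k - 1 - i)))"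
    using assms by (intro sum.reindex_bij_witness[of _ "\<lambda>i. k - 1 - i" "\<lambda>i. k - 1 - i"]) auto
  also have "\<dots> = increment (w \<circ> reversal k) 0 l"
    using assms unfolding increment_def
    by (intro sum.cong) (auto simp: reversal_def)
  finally show ?thesis
    unfolding increment_def by (simp flip: sum_negf)
qed

definition stays_positive :: "nat \<Rightarrow> (nat + nat \<Rightarrow> real) \<Rightarrow> bool" where
  "stays_positive n w \<longleftrightarrow> (\<forall>k\<in>{0<..n}. increment w 0 k > 0)"

section \<open>The position of the minimum\<close>

text \<open>
  The joint law of \<open>X\<close> and \<open>Y\<close> is a product, so Fubini's theorem applies to the diagonal, and each of
  its slices is a single point, a null set for the law of \<open>X\<close>.
\<close>
lemma (in prob_space) AE_neq_if_indep_no_atoms: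
  fixes X Y :: "'a \<Rightarrow> real"
  assumes indep: "indep_var borel X borel Y"
    and no_atoms: "\<And>x. measure (distr M borel X) {x} = 0"
  shows "AE \<omega> in M. X \<omega> \<noteq> Y \<omega>"
proof -
  have rv [measurable]: "X \<in> borel_measurable M" "Y \<in> borel_measurable M"
    using indep_var_rv1[OF indep] indep_var_rv2[OF indep] by auto
  interpret X: prob_space "distr M borel X" by (rule prob_space_distr) simp
  interpret Y: prob_space "distr M borel Y" by (rule prob_space_distr) simp
  interpret XY: pair_sigma_finite "distr M borel X" "distr M borel Y" ..
  let ?D = "{p :: real \<times> real. fst p = snd p}"
  have [measurable]: "?D \<in> sets (borel \<Otimes>\<^sub>M borel)"
  proof -
    have "{p \<in> space (borel \<Otimes>\<^sub>M borel). fst p = (snd p :: real)} \<in> sets (borel \<Otimes>\<^sub>M borel)"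
      by measurable
    then show ?thesis by (simp add: space_pair_measure)
  qed
  have "emeasure M {\<omega> \<in> space M. X \<omega> = Y \<omega>}
      = emeasure (distr M (borel \<Otimes>\<^sub>M borel) (\<lambda>\<omega>. (X \<omega>, Y \<omega>))) ?D"
    by (subst emeasure_distr) (auto intro!: arg_cong[of _ _ "emeasure M"])
  also have "\<dots> = emeasure (distr M borel X \<Otimes>\<^sub>M distr M borel Y) ?D"
    using indep by (simp add: indep_var_distribution_eq)
  also have "\<dots> = (\<integral>\<^sup>+ y. emeasure (distr M borel X) ((\<lambda>x. (x, y)) -` ?D) \<partial>distr M borel Y)"
    by (rule XY.emeasure_pair_measure_alt2) simp
  also have "\<dots> = (\<integral>\<^sup>+ y. emeasure (distr M borel X) {y} \<partial>distr M borel Y)"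
    by (simp add: vimage_def)
  also have "\<dots> = 0"
    by (simp add: X.emeasure_eq_measure no_atoms)
  finally show ?thesis
    by (subst AE_iff_measurable[OF _ refl]) auto
qed

locale continuous_law = real_distribution \<mu> for \<mu> :: "real measure" +
  assumes no_atoms: "measure \<mu> {x} = 0"
begin

abbreviation W :: "(nat + nat \<Rightarrow> real) measure" where
  "W \<equiv> PiM UNIV (\<lambda>_. \<mu>)"

sublocale W: prob_space W
  by (intro prob_space_PiM prob_space_axioms)

lemma space_W: "space W = UNIV"
  by (simp add: space_PiM)

lemma sets_product: "sets (PiM J (\<lambda>_. \<mu>)) = sets (PiM J (\<lambda>_. borel))"
  by (intro sets_PiM_cong) auto

lemma measurable_increment' [measurable]: "(\<lambda>w. increment w j l) \<in> borel_measurable W"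
  using measurable_increment[of j l UNIV] by (simp cong: measurable_cong_sets add: sets_product)

lemma measurable_stays_positive [measurable]: "Measurable.pred W (stays_positive n)"
  unfolding stays_positive_def by measurable

lemma measurable_coordinate: "(\<lambda>w. w i) \<in> borel_measurable W"
  using measurable_component_singleton[of i UNIV "\<lambda>_. \<mu>"] by (simp cong: measurable_cong_sets)

text \<open>
  A family of independent variables with law \<open>\<mu>\<close> has the same joint law as any family of distinct
  coordinates of \<open>W\<close>. This is used twice: it transfers the given variables to \<open>W\<close>, and, applied to
  the coordinates of \<open>W\<close> themselves, it yields the invariance under renaming in \<open>prob_reindex\<close>.
\<close>
lemma prob_iid_family:
  fixes M :: "'b measure" and Z :: "'i \<Rightarrow> 'b \<Rightarrow> real" and f :: "'i \<Rightarrow> nat + nat"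
  assumes M: "prob_space M" and indep: "prob_space.indep_vars M (\<lambda>_. borel) Z I"
    and law: "\<And>i. i \<in> I \<Longrightarrow> distr M borel (Z i) = \<mu>"
    and I: "I \<noteq> {}" and f: "inj_on f I"
    and P: "Measurable.pred (PiM I (\<lambda>_. borel)) P"
  shows "measure M {\<omega> \<in> space M. P (\<lambda>i\<in>I. Z i \<omega>)} = W.prob {w. P (\<lambda>i\<in>I. w (f i))}"
proof -
  interpret M: prob_space M by (fact M)
  let ?B = "PiM I (\<lambda>_. borel :: real measure)"
  have Z: "Z i \<in> borel_measurable M" if "i \<in> I" for i
    using indep that by (auto simp: M.indep_vars_def)
  have "distr M ?B (\<lambda>\<omega>. \<lambda>i\<in>I. Z i \<omega>) = PiM I (\<lambda>i. distr M borel (Z i))"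
    using M.indep_vars_iff_distr_eq_PiM'[OF I, where X = Z and M' = "\<lambda>_. borel"] Z indep by auto
  also have "\<dots> = PiM I (\<lambda>_. \<mu>)"
    by (intro PiM_cong) (auto simp: law)
  also have "\<dots> = distr W (PiM I (\<lambda>_. \<mu>)) (\<lambda>w. \<lambda>i\<in>I. w (f i))"
    using distr_PiM_reindex[of UNIV "\<lambda>_. \<mu>" f I] f prob_space_axioms by simp
  also have "\<dots> = distr W ?B (\<lambda>w. \<lambda>i\<in>I. w (f i))"
    by (intro distr_cong refl sets_product)
  finally have same: "distr M ?B (\<lambda>\<omega>. \<lambda>i\<in>I. Z i \<omega>) = distr W ?B (\<lambda>w. \<lambda>i\<in>I. w (f i))" .
  have E: "{v \<in> space ?B. P v} \<in> sets ?B"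
    using P by simp
  have wf: "(\<lambda>w. \<lambda>i\<in>I. w (f i)) \<in> measurable W ?B"
    by (intro measurable_restrict measurable_coordinate)
  have "measure M {\<omega> \<in> space M. P (\<lambda>i\<in>I. Z i \<omega>)}
      = measure (distr M ?B (\<lambda>\<omega>. \<lambda>i\<in>I. Z i \<omega>)) {v \<in> space ?B. P v}"
    using Z E by (subst measure_distr)
      (auto intro!: measurable_restrict arg_cong[of _ _ "measure M"] simp: space_PiM)
  also have "\<dots> = W.prob {w. P (\<lambda>i\<in>I. w (f i))}"
    using wf E unfolding same by (subst measure_distr)
      (auto intro!: arg_cong[of _ _ "W.prob"] simp: space_PiM space_W)
  finally show ?thesis .
qed

lemma indep_coordinates: "W.indep_vars (\<lambda>_. borel) (\<lambda>i w. w i) UNIV"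
  and distr_coordinate: "distr W borel (\<lambda>w. w i) = \<mu>"
proof -
  show law: "distr W borel (\<lambda>w. w i) = \<mu>" for i
    using distr_PiM_component[of UNIV "\<lambda>_. \<mu>" i] prob_space_axioms
    by (simp cong: distr_cong)
  have "distr W (PiM UNIV (\<lambda>_. borel)) (\<lambda>w. w) = W"
    by (rule distr_id2) (simp add: sets_product)
  then show "W.indep_vars (\<lambda>_. borel) (\<lambda>i w. w i) UNIV"
    by (subst W.indep_vars_iff_distr_eq_PiM') (simp_all add: measurable_coordinate restrict_UNIV law)
qed

lemma prob_reindex:
  assumes "inj f" and "Measurable.pred W P"
  shows "W.prob {w. P (w \<circ> f)} = W.prob {w. P w}"
proof -
  have "Measurable.pred (PiM UNIV (\<lambda>_. borel)) P"
    using assms(2) by (simp cong: measurable_cong_sets add: sets_product)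
  from prob_iid_family[OF W.prob_space_axioms indep_coordinates distr_coordinate _ assms(1) this]
  show ?thesis by (simp add: space_W restrict_UNIV comp_def)
qed

lemma prob_disjoint_coordinates:
  assumes "J \<inter> K = {}"
    and P: "Measurable.pred (PiM J (\<lambda>_. borel)) P" and Q: "Measurable.pred (PiM K (\<lambda>_. borel)) Q"
  shows "W.prob {w. P (restrict w J) \<and> Q (restrict w K)}
       = W.prob {w. P (restrict w J)} * W.prob {w. Q (restrict w K)}"
proof -
  let ?J = "{v \<in> space (PiM J (\<lambda>_. borel)). P v}" and ?K = "{v \<in> space (PiM K (\<lambda>_. borel)). Q v}"
  have "?J \<in> sets (PiM J (\<lambda>_. borel))" "?K \<in> sets (PiM K (\<lambda>_. borel))"
    using P Q by simp_all
  from W.indep_varD[OF W.indep_var_restrict[OF indep_coordinates assms(1)] this]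
  show ?thesis by (simp add: space_W space_PiM vimage_def)
qed

text \<open>
  The increment vanishes only if the single coordinate \<open>Inl j\<close>, whose law has no atoms, takes the
  value \<open>?y\<close> of the proof, a function of the other coordinates and hence independent of it.
\<close>
lemma AE_increment_nonzero:
  assumes "j < l"
  shows "AE w in W. increment w j l \<noteq> 0"
proof -
  let ?K = "window j l - {Inl j}"
  let ?x = "\<lambda>v. v (Inl j) :: real" and ?y = "\<lambda>v. v (Inr j) - increment v (Suc j) l :: real"
  have x: "?x \<in> borel_measurable (PiM {Inl j} (\<lambda>_. borel))"
    by (rule measurable_component_singleton) simp
  have y: "?y \<in> borel_measurable (PiM ?K (\<lambda>_. borel))"
    using assms
    by (intro borel_measurable_diff measurable_increment measurable_component_singleton) auto
  have "W.indep_var borel (\<lambda>w. ?x (restrict w {Inl j})) borel (\<lambda>w. ?y (restrict w ?K))"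
    using W.indep_var_compose[OF W.indep_var_restrict[OF indep_coordinates, of "{Inl j}" ?K] x y]
    by (simp add: comp_def)
  moreover have "increment (restrict w ?K) (Suc j) l = increment w (Suc j) l" for w
    by (rule increment_restrict) auto
  moreover have "Inr j \<in> window j l"
    using assms by auto
  ultimately have "W.indep_var borel ?x borel ?y"
    by simp
  then have "AE w in W. ?x w \<noteq> ?y w"
    by (rule W.AE_neq_if_indep_no_atoms) (simp add: distr_coordinate no_atoms)
  moreover have "increment w j l = ?x w - ?y w" for w
    using assms unfolding increment_def by (simp add: sum.atLeast_Suc_lessThan)
  ultimately show ?thesis by simp
qed

text \<open>
  The event says that the walk on \<open>{0..n}\<close> has its strict minimum at time \<open>k\<close>. Its two conditions
  depend on disjoint sets of steps. The renaming \<open>reversal k\<close> turns the first one into positivity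
  up to time \<open>k\<close>, and \<open>shift k\<close> turns the second one into positivity up to time \<open>n - k\<close>.
\<close>
lemma prob_minimum_at:
  assumes "k \<le> n"
  shows "W.prob {w. (\<forall>j<k. increment w j k < 0) \<and> (\<forall>l\<in>{k<..n}. increment w k l > 0)}
       = W.prob {w. stays_positive k w} * W.prob {w. stays_positive (n - k) w}"
proof -
  let ?P = "\<lambda>v. \<forall>j<k. increment v j k < 0" and ?Q = "\<lambda>v. \<forall>l\<in>{k<..n}. increment v k l > 0"
  let ?J = "window 0 k" and ?K = "window k n"
  have P: "?P (restrict w ?J) = ?P w" for w
    by (intro all_cong1 imp_cong refl arg_cong[of _ _ "\<lambda>x. x < 0"] increment_restrict) auto
  have Q: "?Q (restrict w ?K) = ?Q w" for w
    by (intro ball_cong refl arg_cong[of _ _ "(<) 0"] increment_restrict) auto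
  have mP: "Measurable.pred (PiM ?J (\<lambda>_. borel)) ?P"
    by (intro pred_intros_countable pred_intros_imp' borel_measurable_pred_less measurable_increment) auto
  have mQ: "Measurable.pred (PiM ?K (\<lambda>_. borel)) ?Q"
    by (intro pred_intros_finite borel_measurable_pred_less measurable_increment) auto
  have "?J \<inter> ?K = {}" by auto
  from prob_disjoint_coordinates[OF this mP mQ]
  have "W.prob {w. ?P w \<and> ?Q w} = W.prob {w. ?P w} * W.prob {w. ?Q w}"
    unfolding P Q .
  moreover have "?P w \<longleftrightarrow> stays_positive k (w \<circ> reversal k)" for w
  proof -
    have "stays_positive k (w \<circ> reversal k) \<longleftrightarrow> (\<forall>l\<in>{0<..k}. increment w (k - l) k < 0)"
      by (simp add: stays_positive_def increment_reversal)
    also have "\<dots> \<longleftrightarrow> (\<forall>j\<in>(\<lambda>l. k - l) ` {0<..k}. increment w j k < 0)"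
      by blast
    also have "(\<lambda>l. k - l) ` {0<..k} = {..<k}"
      by (auto intro!: image_eqI[of _ _ "k - _"])
    finally show ?thesis by (simp only: Ball_def lessThan_iff)
  qed
  moreover have "?Q w \<longleftrightarrow> stays_positive (n - k) (w \<circ> shift k)" for w
  proof -
    have "stays_positive (n - k) (w \<circ> shift k) \<longleftrightarrow> (\<forall>l\<in>{0<..n - k}. increment w k (k + l) > 0)"
      by (simp add: stays_positive_def increment_shift)
    also have "\<dots> \<longleftrightarrow> (\<forall>l\<in>(+) k ` {0<..n - k}. increment w k l > 0)"
      by blast
    also have "(+) k ` {0<..n - k} = {k<..n}"
      using assms by simp
    finally show ?thesis by (rule sym)
  qed
  ultimately show ?thesis
    by (simp add: prob_reindex inj_reversal inj_shift)
qed

text \<open>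
  The events \<open>E k\<close> of the proof are disjoint, and a path with pairwise distinct values lies in one
  of them, namely in the one given by its minimizing time.
\<close>
lemma prob_stays_positive_convolution:
  "(\<Sum>k\<le>n. W.prob {w. stays_positive k w} * W.prob {w. stays_positive (n - k) w}) = 1"
proof -
  define E where
    "E k = {w. (\<forall>j<k. increment w j k < 0) \<and> (\<forall>l\<in>{k<..n}. increment w k l > 0)}" for k
  have E: "E k \<in> sets W" for k
  proof -
    have "{w \<in> space W. (\<forall>j<k. increment w j k < 0) \<and> (\<forall>l\<in>{k<..n}. increment w k l > 0)} \<in> sets W"
      by measurable
    then show ?thesis by (simp add: E_def space_W)
  qed
  have disj: "disjoint_family_on E {..n}"
  proof -
    have "E j \<inter> E k = {}" if "j < k" "k \<le> n" for j k
    proof (rule ccontr)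
      assume "E j \<inter> E k \<noteq> {}"
      then obtain w where "w \<in> E j" "w \<in> E k" by auto
      then have "increment w j k > 0" "increment w j k < 0"
        using that by (simp_all add: E_def)
      then show False by simp
    qed
    then show ?thesis
      unfolding disjoint_family_on_def by (metis atMost_iff inf_commute nat_neq_iff)
  qed
  have "AE w in W. \<forall>l. \<forall>j<l. increment w j l \<noteq> 0"
    by (simp add: AE_all_countable AE_increment_nonzero)
  then have "AE w in W. w \<in> (\<Union>k\<le>n. E k)"
  proof eventually_elim
    case (elim w)
    define k where "k = arg_min_on (increment w 0) {..n}"
    have k: "k \<le> n" "\<And>j. j \<le> n \<Longrightarrow> increment w 0 k \<le> increment w 0 j"
      using arg_min_if_finite(1)[of "{..n}" "increment w 0"] arg_min_least[of "{..n}" _ "increment w 0"]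
      by (auto simp: k_def)
    have "increment w j k < 0" if "j < k" for j
    proof -
      have "increment w j k \<noteq> 0" using elim that by blast
      then show ?thesis using that k(1) k(2)[of j] increment_diff[of j k w] by simp
    qed
    moreover have "increment w k l > 0" if "k < l" "l \<le> n" for l
    proof -
      have "increment w k l \<noteq> 0" using elim that by blast
      then show ?thesis using that k(2)[of l] increment_diff[of k l w] by simp
    qed
    ultimately have "w \<in> E k" by (simp add: E_def)
    then show ?case using k(1) by blast
  qed
  then have "1 = W.prob (\<Union>k\<le>n. E k)"
    using E by (subst W.prob_eq_1[THEN iffD2]) auto
  also have "\<dots> = (\<Sum>k\<le>n. W.prob (E k))"
    using E disj by (intro W.finite_measure_finite_Union) auto
  also have "\<dots> = (\<Sum>k\<le>n. W.prob {w. stays_positive k w} * W.prob {w. stays_positive (n - k) w})"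
    unfolding E_def by (intro sum.cong refl prob_minimum_at) simp
  finally show ?thesis by simp
qed

lemma prob_stays_positive:
  "W.prob {w. stays_positive n w} = real ((2 * n) choose n) / 4 ^ n"
proof (rule unique_convolution_square_root)
  show "W.prob {w. stays_positive 0 w} = 1"
    using W.prob_space by (simp add: stays_positive_def space_W)
qed (rule prob_stays_positive_convolution)

end

theorem theorem1:
  fixes M :: "'a measure" and \<mu> :: "real measure"
    and X Y :: "nat \<Rightarrow> 'a \<Rightarrow> real" and n :: nat
  assumes n: "n \<ge> 1"
    and \<mu>: "real_distribution \<mu>"
    and no_atoms: "\<And>x. measure \<mu> {x} = 0"
    and M: "prob_space M"
    and indep: "prob_space.indep_vars M (\<lambda>_. borel) (case_sum X Y) ({1..n} <+> {1..n})"
    and distr_X: "\<And>i. i \<in> {1..n} \<Longrightarrow> distr M borel (X i) = \<mu>"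
    and distr_Y: "\<And>i. i \<in> {1..n} \<Longrightarrow> distr M borel (Y i) = \<mu>"
  shows "measure M {\<omega> \<in> space M. \<forall>k\<in>{1..n}. (\<Sum>i=1..k. X i \<omega>) > (\<Sum>i=1..k. Y i \<omega>)}
           = real ((2 * n) choose n) / 4 ^ n"
proof -
  interpret continuous_law \<mu>
    using \<mu> no_atoms by (simp add: continuous_law_def continuous_law_axioms_def)
  let ?I = "{1..n} <+> {1..n}"
  \<comment> \<open>The given variables are numbered from 1, the steps of the walk from 0.\<close>
  define f :: "nat + nat \<Rightarrow> nat + nat" where "f = map_sum (\<lambda>i. i - 1) (\<lambda>i. i - 1)"
  define P :: "(nat + nat \<Rightarrow> real) \<Rightarrow> bool" where
    "P v \<longleftrightarrow> (\<forall>k\<in>{1..n}. (\<Sum>i=1..k. v (Inr i)) < (\<Sum>i=1..k. v (Inl i)))" for v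
  have law: "distr M borel (case_sum X Y i) = \<mu>" if "i \<in> ?I" for i
    using that distr_X distr_Y by auto
  have inj: "inj_on f ?I"
    by (rule inj_onI) (auto simp: f_def)
  have ne: "?I \<noteq> {}"
    using n by auto
  have meas: "Measurable.pred (PiM ?I (\<lambda>_. borel)) P"
    unfolding P_def
    by (intro pred_intros_finite borel_measurable_pred_less borel_measurable_sum
        measurable_component_singleton) auto
  have "measure M {\<omega> \<in> space M. P (\<lambda>i\<in>?I. case_sum X Y i \<omega>)} = W.prob {w. P (\<lambda>i\<in>?I. w (f i))}"
    by (rule prob_iid_family[OF M indep law ne inj meas])
  moreover have "P (\<lambda>i\<in>?I. case_sum X Y i \<omega>)
      \<longleftrightarrow> (\<forall>k\<in>{1..n}. (\<Sum>i=1..k. X i \<omega>) > (\<Sum>i=1..k. Y i \<omega>))" for \<omega>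
    unfolding P_def by (intro ball_cong refl arg_cong2[of _ _ _ _ "(<)"] sum.cong) auto
  moreover have "P (\<lambda>i\<in>?I. w (f i)) \<longleftrightarrow> stays_positive n w" for w
  proof -
    have "(\<Sum>i=1..k. (\<lambda>i\<in>?I. w (f i)) (s i)) = (\<Sum>i<k. w (s i))"
      if "k \<le> n" "s = Inl \<or> s = Inr" for k s
      using that
      by (intro sum.reindex_bij_witness[of _ Suc "\<lambda>i. i - 1"]) (auto simp: f_def)
    then show ?thesis
      unfolding P_def stays_positive_def increment_def
      by (auto simp: sum_subtractf lessThan_atLeast0 Ball_def)
  qed
  ultimately show ?thesis
    by (simp add: prob_stays_positive)
qed

end
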